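(* Let $p$ be a prime, let $k, n$ be positive integers, let $s\in\{1,\dots,n\}$, $t\in\{1,\dots,p\}$, and let $\alpha\in(0,1)$. Define $$\boldsymbol{B}_{k,s,\ge t}^{\alpha}(n) := \left\{\boldsymbol{a}\in\mathbb{F}_p^n : R_k^{\alpha}(\boldsymbol{b})\ge t\cdot\frac{2^{2k}\cdot|\boldsymbol{b}|^{2k}}{p}\ \text{ for every } \boldsymbol{b}\subseteq\boldsymbol{a} \text{ with } |\boldsymbol{b}|\ge s\right\}.$$ Then $$|\boldsymbol{B}_{k,s,\ge t}^{\alpha}(n)| \le \left(\frac{s}{n}\right)^{2k-1}(\alpha t)^{s-n}\,p^n.$$
   Context: For a finite-dimensional vector $\boldsymbol{b}=(b_1,\dots,b_m)\in\mathbb{F}_p^m$, $|\boldsymbol{b}|=m$ denotes its dimension. We write $\boldsymbol{b}\subseteq\boldsymbol{a}$ if $\boldsymbol{b}$ is a subvector of $\boldsymbol{a}$, i.e. $\boldsymbol{b}$ is the restriction $(a_i)_{i\in I}$ of $\boldsymbol{a}$ to some subset $I$ of its index set. For a positive integer $k$ and $\alpha\in[0,1]$, $R_k^{\alpha}(\boldsymbol{b})$ is the number of solutions to $\pm b_{i_1}\pm b_{i_2}\pm\dots\pm b_{i_{2k}}=0$ in $\mathbb{F}_p$ satisfying $|\{i_1,\dots,i_{2k}\}|\ge(1+\alpha)k$; that is, the number of pairs consisting of a sequence $(i_1,\dots,i_{2k})\in\{1,\dots,m\}^{2k}$ with at least $(1+\alpha)k$ distinct entries and a sign pattern $(\eta_1,\dots,\eta_{2k})\in\{\pm1\}^{2k}$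 such that $\sum_{j}\eta_j b_{i_j}=0$ in $\mathbb{F}_p$. *)

theory Defs
  imports Complex_Main "Berlekamp_Zassenhaus.Finite_Field"
begin

text \<open>
  The prime field with p elements is \<open>'p mod_ring\<close> for a type \<open>'p\<close> of class
  \<open>prime_card\<close>, with \<open>p = CARD('p)\<close>.  A vector is the list of its coordinates, so
  its dimension is the length of the list, and coordinates are indexed from 0.
\<close>

definition subvector :: "'a list \<Rightarrow> 'a list \<Rightarrow> bool" where
  "subvector b a \<longleftrightarrow> (\<exists>I. b = nths a I)"

text \<open>
  Signs are integers, so that \<open>1\<close> and \<open>-1\<close> are still different signs, and are
  counted separately, when \<open>p = 2\<close>.
\<close>

definition solutions ::
  "nat \<Rightarrow> real \<Rightarrow> 'p::prime_card mod_ring list \<Rightarrow> (nat list \<times> int list) set" where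
  "solutions k \<alpha> b =
     {(i, \<eta>). length i = 2 * k \<and> set i \<subseteq> {..<length b} \<and>
        length \<eta> = 2 * k \<and> set \<eta> \<subseteq> {1, -1} \<and>
        real (card (set i)) \<ge> (1 + \<alpha>) * real k \<and>
        (\<Sum>j<2 * k. of_int (\<eta> ! j) * b ! (i ! j)) = 0}"

definition R :: "nat \<Rightarrow> real \<Rightarrow> 'p::prime_card mod_ring list \<Rightarrow> nat" where
  "R k \<alpha> b = card (solutions k \<alpha> b)"

definition B ::
  "nat \<Rightarrow> nat \<Rightarrow> nat \<Rightarrow> real \<Rightarrow> nat \<Rightarrow> 'p::prime_card mod_ring list set" where
  "B k s t \<alpha> n =
     {a. length a = n \<and>
        (\<forall>b. subvector b a \<and> length b \<ge> s \<longrightarrow>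
           real (R k \<alpha> b) \<ge>
             real t * (2 ^ (2 * k) * real (length b) ^ (2 * k) / real CARD('p)))}"

end

theory Submission
  imports Defs "HOL-Library.Sublist" "HOL-Combinatorics.Permutations"
begin

text \<open>
  The proof is a double count that compares dimension \<open>n > s\<close> with dimension \<open>n - 1\<close>.  Count the
  pairs of a vector \<open>a\<close> in \<open>B k s t \<alpha> n\<close> and a solution for \<open>a\<close> whose last index occurs at no
  other position.

  From below: a sequence of \<open>2 * k\<close> indices with at least \<open>(1 + \<alpha>) * k\<close> different values has at
  least \<open>2 * \<alpha> * k\<close> positions whose value is not repeated (\<open>twice_card_set_le\<close>).  The set of
  solutions is invariant under permutations of the positions, so by averaging at least a
  proportion \<open>\<alpha>\<close> of the solutions has an unrepeated last index
  (\<open>card_last_lone_solutions_ge\<close>).  As \<open>a\<close> is a subvector of itself of dimension at least \<open>s\<close>,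
  each \<open>a\<close> is thus in at least
  \<open>\<alpha> * t * 2 ^ (2 * k) * n ^ (2 * k) / p\<close> pairs.

  From above: when the last index is unrepeated, the linear equation determines that coordinate of
  \<open>a\<close> from the other coordinates.  So the pair can be recovered after that coordinate has been
  deleted (\<open>delete_nth_inj\<close>), and what is left of \<open>a\<close> is in \<open>B k s t \<alpha> (n - 1)\<close>.  There are only
  \<open>n * (n - 1) ^ (2 * k - 1) * 2 ^ (2 * k)\<close> choices for the indices and signs.

  Comparing both bounds gives, with \<open>B(n)\<close> short for \<open>B k s t \<alpha> n\<close>,
  \<open>|B(n)| \<le> ((n - 1) / n) ^ (2 * k - 1) * (p / (\<alpha> * t)) * |B(n - 1)|\<close>.  The factors
  \<open>(n - 1) / n\<close> telescope when this is iterated down to dimension \<open>s\<close>, where the trivial bound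
  \<open>p ^ s\<close> is used.
\<close>

section \<open>Positions with an unrepeated value\<close>

definition lone :: "'a list \<Rightarrow> nat \<Rightarrow> bool" where
  "lone xs j \<longleftrightarrow> (\<forall>q<length xs. q \<noteq> j \<longrightarrow> xs ! q \<noteq> xs ! j)"

text \<open>
  Give each position weight 1, and weight 2 if its value is not repeated.  Then the positions
  of each single value have total weight at least 2.
\<close>

lemma twice_card_set_le:
  "2 * card (set xs) \<le> length xs + card {j. j < length xs \<and> lone xs j}"
proof -
  define h :: "nat \<Rightarrow> nat" where "h j = 1 + of_bool (lone xs j)" for j
  have set: "set xs = (\<lambda>j. xs ! j) ` {..<length xs}"
    by (auto simp: set_conv_nth)
  have weight: "2 \<le> sum h {j \<in> {..<length xs}. xs ! j = v}" if "v \<in> set xs" for v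
  proof -
    let ?F = "{j \<in> {..<length xs}. xs ! j = v}"
    obtain j where j: "j \<in> ?F" using \<open>v \<in> set xs\<close> by (auto simp: set_conv_nth)
    show ?thesis
    proof (cases "lone xs j")
      case True
      then have "2 \<le> h j" by (simp add: h_def)
      also have "\<dots> \<le> sum h ?F" using j by (intro member_le_sum) auto
      finally show ?thesis .
    next
      case False
      then obtain q where q: "q \<in> ?F" "q \<noteq> j" using j by (auto simp: lone_def)
      have "2 \<le> sum h {j, q}" using q(2) by (simp add: h_def)
      also have "\<dots> \<le> sum h ?F" using j q by (intro sum_mono2) auto
      finally show ?thesis .
    qed
  qed
  have "2 * card (set xs) = (\<Sum>v\<in>set xs. 2)" by simp
  also have "\<dots> \<le> (\<Sum>v\<in>set xs. sum h {j \<in> {..<length xs}. xs ! j = v})"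
    by (intro sum_mono weight)
  also have "\<dots> = sum h {..<length xs}"
    unfolding set by (rule sum.image_gen[symmetric]) simp
  also have "\<dots> = length xs + card {j. j < length xs \<and> lone xs j}"
    by (simp add: h_def sum_Suc sum_of_bool_eq Int_def)
  finally show ?thesis .
qed

section \<open>Solutions with an unrepeated last index\<close>

lemma finite_solutions: "finite (solutions k \<alpha> b)"
proof (rule finite_subset)
  show "solutions k \<alpha> b \<subseteq> {i. set i \<subseteq> {..<length b} \<and> length i = 2 * k}
      \<times> {\<eta>. set \<eta> \<subseteq> {1, -1} \<and> length \<eta> = 2 * k}"
    by (auto simp: solutions_def)
qed (simp add: finite_lists_length_eq)

lemma solutions_permute:
  assumes x: "(i, \<eta>) \<in> solutions k \<alpha> b" and f: "f permutes {..<2 * k}"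
  shows "(permute_list f i, permute_list f \<eta>) \<in> solutions k \<alpha> b"
proof -
  have len: "length i = 2 * k" "length \<eta> = 2 * k"
    using x by (auto simp: solutions_def)
  have "(\<Sum>j<2 * k. of_int (permute_list f \<eta> ! j) * b ! (permute_list f i ! j))
      = (\<Sum>j<2 * k. of_int (\<eta> ! f j) * b ! (i ! f j))"
    using f len by (intro sum.cong) (auto simp: permute_list_nth)
  also have "\<dots> = (\<Sum>j<2 * k. of_int (\<eta> ! j) * b ! (i ! j))"
    using sum.permute[OF f, of "\<lambda>j. of_int (\<eta> ! j) * b ! (i ! j)"] by (simp add: o_def)
  finally show ?thesis
    using x f len by (auto simp: solutions_def)
qed

lemma lone_permute:
  assumes f: "f permutes {..<length xs}" and j: "j < length xs" and l: "lone xs (f j)"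
  shows "lone (permute_list f xs) j"
  unfolding lone_def
proof (intro allI impI)
  fix q assume q: "q < length (permute_list f xs)" "q \<noteq> j"
  have "f q \<noteq> f j" using q(2) permutes_inj[OF f] by (auto dest: injD)
  moreover have "f q < length xs" using permutes_in_image[OF f, of q] q by simp
  ultimately show "permute_list f xs ! q \<noteq> permute_list f xs ! j"
    using f j q l by (auto simp: permute_list_nth lone_def)
qed

definition last_lone_solutions ::
  "nat \<Rightarrow> real \<Rightarrow> 'p::prime_card mod_ring list \<Rightarrow> (nat list \<times> int list) set" where
  "last_lone_solutions k \<alpha> b = {x \<in> solutions k \<alpha> b. lone (fst x) (2 * k - 1)}"

text \<open>
  Exchanging position \<open>j\<close> with the last position is an injection, so no position is unrepeated
  in more solutions than the last one.
\<close>

lemma card_lone_solutions_le: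
  assumes j: "j < 2 * k"
  shows "card {x \<in> solutions k \<alpha> b. lone (fst x) j} \<le> card (last_lone_solutions k \<alpha> b)"
proof (rule card_inj_on_le)
  define f where "f = Transposition.transpose j (2 * k - 1)"
  define g :: "nat list \<times> int list \<Rightarrow> nat list \<times> int list"
    where "g = map_prod (permute_list f) (permute_list f)"
  have f: "f permutes {..<2 * k}"
    unfolding f_def using j by (intro permutes_swap_id) auto
  show "inj_on g {x \<in> solutions k \<alpha> b. lone (fst x) j}"
  proof (rule inj_on_inverseI)
    fix x assume "x \<in> {x \<in> solutions k \<alpha> b. lone (fst x) j}"
    then have len: "length (fst x) = 2 * k" "length (snd x) = 2 * k"
      by (auto simp: solutions_def)
    have "permute_list f (permute_list f xs) = xs" if "length xs = 2 * k" for xs :: "'z list"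
      using permute_list_compose[of f xs f] f that by (simp add: f_def)
    from this[OF len(1)] this[OF len(2)] show "g (g x) = x"
      by (cases x) (simp add: g_def)
  qed
  show "g ` {x \<in> solutions k \<alpha> b. lone (fst x) j} \<subseteq> last_lone_solutions k \<alpha> b"
  proof
    fix y assume "y \<in> g ` {x \<in> solutions k \<alpha> b. lone (fst x) j}"
    then obtain i \<eta> where y: "y = g (i, \<eta>)" and x: "(i, \<eta>) \<in> solutions k \<alpha> b" and l: "lone i j"
      by auto
    have len: "length i = 2 * k" using x by (auto simp: solutions_def)
    have "lone (permute_list f i) (2 * k - 1)"
      using f len j l by (intro lone_permute) (auto simp: f_def)
    then show "y \<in> last_lone_solutions k \<alpha> b"
      using solutions_permute[OF x f] by (simp add: y g_def last_lone_solutions_def)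
  qed
  show "finite (last_lone_solutions k \<alpha> b)"
    by (simp add: last_lone_solutions_def finite_solutions)
qed

text \<open>
  Every solution has at least \<open>2 * \<alpha> * k\<close> of its \<open>2 * k\<close> positions unrepeated, and by symmetry
  the last position has at least the average share of these.
\<close>

lemma card_last_lone_solutions_ge:
  assumes "k \<ge> 1"
  shows "\<alpha> * real (R k \<alpha> b) \<le> real (card (last_lone_solutions k \<alpha> b))"
proof -
  let ?S = "solutions k \<alpha> b"
  have many: "2 * \<alpha> * real k \<le> real (card {j. j < 2 * k \<and> lone (fst x) j})" if "x \<in> ?S" for x
  proof -
    have "length (fst x) = 2 * k" "(1 + \<alpha>) * real k \<le> real (card (set (fst x)))"
      using that by (auto simp: solutions_def)
    then show ?thesis
      using twice_card_set_le[of "fst x"] by (simp add: algebra_simps)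
  qed
  have "2 * \<alpha> * real k * real (card ?S) = (\<Sum>x\<in>?S. 2 * \<alpha> * real k)" by simp
  also have "\<dots> \<le> (\<Sum>x\<in>?S. real (card {j. j < 2 * k \<and> lone (fst x) j}))"
    by (intro sum_mono many)
  also have "\<dots> = real (\<Sum>x\<in>?S. \<Sum>j<2 * k. of_bool (lone (fst x) j))"
    by (simp add: sum_of_bool_eq Int_def conj_commute)
  also have "\<dots> = real (\<Sum>j<2 * k. \<Sum>x\<in>?S. of_bool (lone (fst x) j))"
    by (subst sum.swap) (rule refl)
  also have "\<dots> = real (\<Sum>j<2 * k. card {x \<in> ?S. lone (fst x) j})"
    by (simp add: sum_of_bool_eq finite_solutions Int_def conj_commute)
  also have "\<dots> \<le> real (\<Sum>j<2 * k. card (last_lone_solutions k \<alpha> b))"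
    by (intro of_nat_mono sum_mono card_lone_solutions_le) simp
  also have "\<dots> = 2 * real k * real (card (last_lone_solutions k \<alpha> b))" by simp
  finally have "2 * real k * (\<alpha> * real (card ?S))
      \<le> 2 * real k * real (card (last_lone_solutions k \<alpha> b))"
    by (simp add: mult_ac)
  then show ?thesis
    using assms by (simp add: R_def)
qed

text \<open>
  The indices and signs that a solution with unrepeated last index can have in dimension \<open>n\<close>,
  whatever the vector: the factor of the count from above that does not depend on \<open>a\<close>.
\<close>

definition last_lone_patterns :: "nat \<Rightarrow> nat \<Rightarrow> (nat list \<times> int list) set" where
  "last_lone_patterns k n =
     {i. length i = 2 * k \<and> set i \<subseteq> {..<n} \<and> lone i (2 * k - 1)}
       \<times> {\<eta>. set \<eta> \<subseteq> {1, -1} \<and> length \<eta> = 2 * k}"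

lemma finite_last_lone_patterns: "finite (last_lone_patterns k n)"
proof (rule finite_subset)
  show "last_lone_patterns k n \<subseteq> {i. set i \<subseteq> {..<n} \<and> length i = 2 * k}
      \<times> {\<eta>. set \<eta> \<subseteq> {1, -1} \<and> length \<eta> = 2 * k}"
    by (auto simp: last_lone_patterns_def)
qed (simp add: finite_lists_length_eq)

lemma card_last_lone_patterns_le:
  assumes "k \<ge> 1"
  shows "card (last_lone_patterns k n) \<le> n * (n - 1) ^ (2 * k - 1) * 2 ^ (2 * k)"
proof -
  define A where
    "A = Sigma {..<n} (\<lambda>r. {xs. set xs \<subseteq> {..<n} - {r} \<and> length xs = 2 * k - 1})"
  have finA: "finite A"
    unfolding A_def by (intro finite_SigmaI finite_lists_length_eq) auto
  have "{i. length i = 2 * k \<and> set i \<subseteq> {..<n} \<and> lone i (2 * k - 1)}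
      \<subseteq> (\<lambda>(r, xs). xs @ [r]) ` A"
  proof
    fix i assume "i \<in> {i. length i = 2 * k \<and> set i \<subseteq> {..<n} \<and> lone i (2 * k - 1)}"
    then have i: "length i = 2 * k" "set i \<subseteq> {..<n}" "lone i (2 * k - 1)" by auto
    then have "i \<noteq> []" using assms by auto
    then obtain xs r where xs: "i = xs @ [r]" by (cases i rule: rev_cases) auto
    have len: "length xs = 2 * k - 1" using i(1) xs by simp
    have "r \<notin> set xs"
    proof
      assume "r \<in> set xs"
      then obtain q where "q < length xs" "xs ! q = r" by (auto simp: in_set_conv_nth)
      moreover from this have "i ! q \<noteq> i ! (2 * k - 1)"
        using i(1,3) len by (simp add: lone_def)
      ultimately show False using len by (simp add: xs nth_append)
    qed
    then have "(r, xs) \<in> A" using i(2) len by (auto simp: A_def xs)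
    then show "i \<in> (\<lambda>(r, xs). xs @ [r]) ` A" using xs by force
  qed
  then have "card {i. length i = 2 * k \<and> set i \<subseteq> {..<n} \<and> lone i (2 * k - 1)} \<le> card A"
    using finA by (rule surj_card_le[rotated])
  also have "card A = n * (n - 1) ^ (2 * k - 1)"
    by (simp add: A_def card_SigmaI finite_lists_length_eq card_lists_length_eq)
  finally have "card {i. length i = 2 * k \<and> set i \<subseteq> {..<n} \<and> lone i (2 * k - 1)}
      \<le> n * (n - 1) ^ (2 * k - 1)" .
  moreover have "card {\<eta> :: int list. set \<eta> \<subseteq> {1, -1} \<and> length \<eta> = 2 * k} = 2 ^ (2 * k)"
    by (subst card_lists_length_eq) (simp_all add: numeral_2_eq_2)
  ultimately show ?thesis
    unfolding last_lone_patterns_def card_cartesian_product by simp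
qed

section \<open>Deleting a coordinate\<close>

definition delete_nth :: "nat \<Rightarrow> 'a list \<Rightarrow> 'a list" where
  "delete_nth r a = take r a @ drop (Suc r) a"

lemma nth_delete_nth_eq:
  assumes "delete_nth r a = delete_nth r b" "length a = length b" "q \<noteq> r" "q < length a"
  shows "a ! q = b ! q"
proof (cases "r < length a")
  case True
  then have "take r a = take r b" "drop (Suc r) a = drop (Suc r) b"
    using assms(1,2) by (auto simp: delete_nth_def append_eq_append_conv)
  show ?thesis
  proof (cases "q < r")
    case True
    then show ?thesis using \<open>take r a = take r b\<close> by (metis nth_take)
  next
    case False
    then have "q = Suc r + (q - Suc r)" using assms(3) by simp
    then show ?thesis using \<open>drop (Suc r) a = drop (Suc r) b\<close> assms(2,4)
      by (metis Suc_leI nth_drop True)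
  qed
next
  case False
  then show ?thesis using assms by (simp add: delete_nth_def)
qed

lemma subvector_iff_subseq: "subvector b a \<longleftrightarrow> subseq b a"
  by (simp add: subvector_def subseq_conv_nths)

lemma subseq_delete_nth: "subseq (delete_nth r a) a"
proof -
  have "subseq (take r a @ drop (Suc r) a) (take r a @ drop r a)"
    using suffix_imp_subseq[OF suffix_drop, of 1 "drop r a"]
    by (intro list_emb_append_mono) simp_all
  then show ?thesis by (simp add: delete_nth_def)
qed

lemma delete_nth_in_B:
  assumes a: "a \<in> B k s t \<alpha> (Suc m)" and r: "r < Suc m"
  shows "delete_nth r a \<in> B k s t \<alpha> m"
proof -
  have "length a = Suc m" using a by (simp add: B_def)
  then have "length (delete_nth r a) = m" using r by (simp add: delete_nth_def)
  moreover have "subseq b a" if "subseq b (delete_nth r a)" for b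
    using that subseq_delete_nth by (rule subseq_order.order_trans)
  ultimately show ?thesis
    using a by (auto simp: B_def subvector_iff_subseq)
qed

text \<open>
  The deleted coordinate occurs in exactly one term of the equation, with coefficient \<open>1\<close> or
  \<open>-1\<close>, so the equation can be solved for it.
\<close>

lemma delete_nth_inj:
  assumes k: "k \<ge> 1"
    and a: "(i, \<eta>) \<in> last_lone_solutions k \<alpha> a" and b: "(i, \<eta>) \<in> last_lone_solutions k \<alpha> b"
    and len: "length a = length b"
    and del: "delete_nth (i ! (2 * k - 1)) a = delete_nth (i ! (2 * k - 1)) b"
  shows "a = b"
proof -
  define l where "l = 2 * k - 1"
  define r where "r = i ! l"
  have l: "2 * k = Suc l" using k by (simp add: l_def)
  have i: "length i = Suc l" "set i \<subseteq> {..<length a}" "length \<eta> = Suc l" "set \<eta> \<subseteq> {1, -1}"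
    "lone i l"
    using a by (auto simp: last_lone_solutions_def solutions_def l)
  have other: "a ! q = b ! q" if "q \<noteq> r" "q < length a" for q
    using del len that by (intro nth_delete_nth_eq[of r]) (auto simp: r_def l_def)
  have terms: "(\<Sum>j<l. of_int (\<eta> ! j) * a ! (i ! j)) = (\<Sum>j<l. of_int (\<eta> ! j) * b ! (i ! j))"
  proof (rule sum.cong)
    fix j assume "j \<in> {..<l}"
    then have "i ! j \<noteq> r" "i ! j \<in> set i"
      using i(1,5) by (auto simp: lone_def r_def)
    then have "a ! (i ! j) = b ! (i ! j)"
      using i(2) by (intro other) auto
    then show "of_int (\<eta> ! j) * a ! (i ! j) = of_int (\<eta> ! j) * b ! (i ! j)" by simp
  qed simp
  have "(\<Sum>j<l. of_int (\<eta> ! j) * a ! (i ! j)) + of_int (\<eta> ! l) * a ! r = 0"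
    "(\<Sum>j<l. of_int (\<eta> ! j) * b ! (i ! j)) + of_int (\<eta> ! l) * b ! r = 0"
    using a b by (auto simp: last_lone_solutions_def solutions_def l r_def)
  then have "of_int (\<eta> ! l) * a ! r = of_int (\<eta> ! l) * b ! r"
    unfolding terms by (metis add_left_cancel)
  moreover have "\<eta> ! l \<in> {1, -1}"
    using i(4) nth_mem[of l \<eta>] unfolding i(3) by blast
  ultimately have "a ! r = b ! r" by auto
  then show ?thesis
    using len other by (intro nth_equalityI) metis+
qed

section \<open>Comparing consecutive dimensions\<close>

lemma finite_B: "finite (B k s t \<alpha> n :: 'p::prime_card mod_ring list set)"
  by (rule finite_subset[OF _ finite_lists_length_eq[of UNIV n]]) (auto simp: B_def)

lemma card_B_le_power:
  "card (B k s t \<alpha> n :: 'p::prime_card mod_ring list set) \<le> CARD('p) ^ n"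
proof -
  have "card (B k s t \<alpha> n :: 'p mod_ring list set)
      \<le> card {a :: 'p mod_ring list. set a \<subseteq> UNIV \<and> length a = n}"
    by (intro card_mono finite_lists_length_eq) (auto simp: B_def)
  also have "\<dots> = CARD('p) ^ n"
    by (subst card_lists_length_eq) (auto simp: CARD_mod_ring)
  finally show ?thesis .
qed

lemma sum_last_lone_solutions_le:
  assumes k: "k \<ge> 1"
  shows "(\<Sum>a\<in>B k s t \<alpha> (Suc m). card (last_lone_solutions k \<alpha> (a :: 'p::prime_card mod_ring list)))
    \<le> card (B k s t \<alpha> m :: 'p mod_ring list set) * card (last_lone_patterns k (Suc m))"
proof -
  let ?B = "B k s t \<alpha> :: nat \<Rightarrow> 'p mod_ring list set"
  let ?P = "Sigma (?B (Suc m)) (last_lone_solutions k \<alpha>)"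
  let ?g = "\<lambda>(a, x). (delete_nth (fst x ! (2 * k - 1)) a, x)"
  have "card ?P \<le> card (?B m \<times> last_lone_patterns k (Suc m))"
  proof (rule card_inj_on_le)
    show "inj_on ?g ?P"
    proof (rule inj_onI)
      fix u v assume uv: "u \<in> ?P" "v \<in> ?P" "?g u = ?g v"
      obtain a i \<eta> where u: "u = (a, (i, \<eta>))" by (metis surj_pair)
      obtain b where v: "v = (b, (i, \<eta>))" using uv(3) by (cases v) (auto simp: u)
      have "a = b"
      proof (rule delete_nth_inj[OF k])
        show "(i, \<eta>) \<in> last_lone_solutions k \<alpha> a" "(i, \<eta>) \<in> last_lone_solutions k \<alpha> b"
          "length a = length b" using uv(1,2) by (auto simp: u v B_def)
        show "delete_nth (i ! (2 * k - 1)) a = delete_nth (i ! (2 * k - 1)) b"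
          using uv(3) by (simp add: u v)
      qed
      then show "u = v" by (simp add: u v)
    qed
    show "?g ` ?P \<subseteq> ?B m \<times> last_lone_patterns k (Suc m)"
    proof
      fix y assume "y \<in> ?g ` ?P"
      then obtain a i \<eta> where y: "y = ?g (a, (i, \<eta>))" and a: "a \<in> ?B (Suc m)"
        and x: "(i, \<eta>) \<in> last_lone_solutions k \<alpha> a" by force
      have "length a = Suc m" using a by (simp add: B_def)
      then have i: "length i = 2 * k" "set i \<subseteq> {..<Suc m}"
        and pat: "(i, \<eta>) \<in> last_lone_patterns k (Suc m)"
        using x by (auto simp: last_lone_solutions_def solutions_def last_lone_patterns_def)
      have "i ! (2 * k - 1) \<in> set i" using i(1) k by simp
      then have "delete_nth (i ! (2 * k - 1)) a \<in> ?B m"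
        using i(2) by (intro delete_nth_in_B[OF a]) auto
      then show "y \<in> ?B m \<times> last_lone_patterns k (Suc m)" using pat by (simp add: y)
    qed
    show "finite (?B m \<times> last_lone_patterns k (Suc m))"
      by (simp add: finite_B finite_last_lone_patterns)
  qed
  moreover have "finite (last_lone_solutions k \<alpha> a)" for a :: "'p mod_ring list"
    by (simp add: last_lone_solutions_def finite_solutions)
  ultimately show ?thesis
    by (simp add: card_SigmaI finite_B card_cartesian_product)
qed

lemma card_B_Suc_le:
  assumes k: "k \<ge> 1" and s: "s \<le> Suc m" and t: "t \<ge> 1" and \<alpha>: "0 < \<alpha>"
  shows "real (card (B k s t \<alpha> (Suc m) :: 'p::prime_card mod_ring list set))
    \<le> (real m / real (Suc m)) ^ (2 * k - 1) * (real CARD('p) / (\<alpha> * real t))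
      * real (card (B k s t \<alpha> m :: 'p mod_ring list set))"
proof -
  let ?B = "B k s t \<alpha> :: nat \<Rightarrow> 'p mod_ring list set"
  define M where "M = real (Suc m)"
  define e where "e = 2 * k - 1"
  have "2 * k = Suc e" using k by (simp add: e_def)
  then have Me: "M ^ (2 * k) = M * M ^ e" by simp
  have M: "M > 0" by (simp add: M_def)
  have p: "real CARD('p) > 0" by simp
  let ?L = "\<alpha> * (real t * (2 ^ (2 * k) * M ^ (2 * k) / real CARD('p)))"
  have "?L \<le> real (card (last_lone_solutions k \<alpha> a))" if "a \<in> ?B (Suc m)" for a
  proof -
    have "subvector a a" "length a = Suc m"
      using that by (auto simp: subvector_iff_subseq B_def)
    then have "real t * (2 ^ (2 * k) * M ^ (2 * k) / real CARD('p)) \<le> real (R k \<alpha> a)"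
      using that s by (auto simp: B_def M_def)
    then have "?L \<le> \<alpha> * real (R k \<alpha> a)" using \<alpha> by (intro mult_left_mono) auto
    also have "\<dots> \<le> real (card (last_lone_solutions k \<alpha> a))"
      by (rule card_last_lone_solutions_ge[OF k])
    finally show ?thesis .
  qed
  then have "(\<Sum>a\<in>?B (Suc m). ?L) \<le> (\<Sum>a\<in>?B (Suc m). real (card (last_lone_solutions k \<alpha> a)))"
    by (rule sum_mono)
  then have "real (card (?B (Suc m))) * ?L
      \<le> real (\<Sum>a\<in>?B (Suc m). card (last_lone_solutions k \<alpha> a))" by simp
  also have "\<dots> \<le> real (card (?B m) * card (last_lone_patterns k (Suc m)))"
    by (intro of_nat_mono sum_last_lone_solutions_le k)
  also have "\<dots> \<le> real (card (?B m) * (Suc m * m ^ e * 2 ^ (2 * k)))"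
    using card_last_lone_patterns_le[OF k, of "Suc m"]
    by (intro of_nat_mono mult_left_mono) (auto simp: e_def)
  also have "\<dots> = real (card (?B m)) * (M * real m ^ e * 2 ^ (2 * k))"
    by (simp add: M_def del: of_nat_Suc mult_Suc)
  finally have "real (card (?B (Suc m))) \<le> real (card (?B m)) * (M * real m ^ e * 2 ^ (2 * k)) / ?L"
    using \<alpha> t M p by (subst pos_le_divide_eq) auto
  also have "\<dots> = (real m / M) ^ e * (real CARD('p) / (\<alpha> * real t)) * real (card (?B m))"
    unfolding Me using \<alpha> t M p by (simp add: field_simps)
  finally show ?thesis by (simp add: M_def e_def)
qed

theorem theorem1p7:
  fixes k n s t :: nat and \<alpha> :: real
  assumes "k \<ge> 1" and "n \<ge> 1"
    and "s \<in> {1..n}" and "t \<in> {1..CARD('p::prime_card)}"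
    and "0 < \<alpha>" and "\<alpha> < 1"
  shows "real (card (B k s t \<alpha> n :: 'p mod_ring list set))
    \<le> (real s / real n) ^ (2 * k - 1) * (\<alpha> * real t) powi (int s - int n) * real CARD('p) ^ n"
proof -
  let ?B = "B k s t \<alpha> :: nat \<Rightarrow> 'p mod_ring list set"
  define c where "c = \<alpha> * real t"
  have s: "s \<ge> 1" "s \<le> n" and t: "t \<ge> 1" using assms by auto
  have c: "c > 0" using assms by (auto simp: c_def)
  from s(2) have "real (card (?B n))
    \<le> (real s / real n) ^ (2 * k - 1) * c powi (int s - int n) * real CARD('p) ^ n"
  proof (induction n rule: dec_induct)
    case base
    have "real (card (?B s)) \<le> real (CARD('p) ^ s)"
      by (intro of_nat_mono card_B_le_power)
    then show ?case using s by simp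
  next
    case (step m)
    have m: "real m > 0" using step s by simp
    have powi: "c powi (int s - int (Suc m)) = c powi (int s - int m) / c"
      using c power_int_diff[of c "int s - int m" 1] by (simp add: algebra_simps)
    have "real (card (?B (Suc m))) \<le> (real m / real (Suc m)) ^ (2 * k - 1)
        * (real CARD('p) / c) * real (card (?B m))"
      unfolding c_def using step assms t by (intro card_B_Suc_le) auto
    also have "\<dots> \<le> (real m / real (Suc m)) ^ (2 * k - 1) * (real CARD('p) / c)
        * ((real s / real m) ^ (2 * k - 1) * c powi (int s - int m) * real CARD('p) ^ m)"
      using c by (intro mult_left_mono step.IH) auto
    also have "\<dots> = (real m / real (Suc m) * (real s / real m)) ^ (2 * k - 1)
        * (c powi (int s - int m) / c) * real CARD('p) ^ Suc m"
      unfolding power_mult_distrib by (simp add: mult_ac del: of_nat_Suc)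
    also have "real m / real (Suc m) * (real s / real m) = real s / real (Suc m)"
      using m by simp
    finally show ?case by (simp only: powi)
  qed
  then show ?thesis by (simp add: c_def)
qed

end
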